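(* Let $k$ be a positive integer, let $a\in\mathbb{R}$, and let $\mathfrak{S}=\{x\in\mathbb{C}: -1\le \operatorname{Im}(x)\le 0\}$. Let $F(z)$, with $z=a\,x(x+i)$, be analytic for $x\in\mathfrak{S}$ and diverge less quickly than $e^{\pi|x|}/x$ as $\operatorname{Re}(x)\to\pm\infty$. Then, for $b\in\mathbb{C}$ where the integral exists, $$\int_{-\infty}^{\infty}\frac{F(a\,x(x+i))\cosh(\pi(2k-1)x)}{\cosh^2(\pi b)+\sinh^2(\pi(2k-1)x)}\,dx=\int_{-\infty}^{\infty}\frac{F(a\,x(x+i))\cosh(\pi(2k-1)x)}{\cosh(\pi(b+(2k-1)x))\,\cosh(\pi(b-(2k-1)x))}\,dx$$ $$=\frac{1}{(2k-1)\cosh(\pi b)}\sum_{n=1}^{2k-1}(-1)^{n+1}F\!\left(-\frac{i\,a\,(2ib-2n-1+4k)\,(i(2n-1)+2b)}{4(2k-1)^2}\right),$$ and the right-hand side provides an analytic continuation for those regions of $b$ where the integral does not exist. If $b=0$, the formula reduces to $$\int_{-\infty}^{\infty}\frac{F(a\,x(x+i))}{\cosh(\pi(2k-1)x)}\,dx=\frac{(-1)^{k+1}F(a/4)}{2k-1}-\frac{2(-1)^k}{2k-1}\sum_{n=1}^{k-1}(-1)^nF\!\left(\frac{a\,((2k-1)^2-4n^2)}{4(2k-1)^2}\right).$$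
   Context: Here $F$ is a complex function of $z=a\,x(x+i)$, where $x$ is a complex variable. A sum vanishes when its lower limit exceeds its upper limit.
   Formalization: The formula is proved for b with |Im b| ≤ 1/2 and cosh(πb) ≠ 0 where the integral exists; for other b it fails (F = 1, k = 1, b = i: the integral is 1, the sum is −1), and at cosh(πb) = 0 the right-hand side is undefined. *)

theory Defs
  imports "HOL-Complex_Analysis.Complex_Analysis" "HOL-Library.Landau_Symbols"
begin

definition z_of :: "real \<Rightarrow> complex \<Rightarrow> complex" where
  "z_of a x = of_real a * x * (x + \<i>)"

definition closed_strip :: "complex set" where
  "closed_strip = {x. -1 \<le> Im x \<and> Im x \<le> 0}"

definition sample_point :: "real \<Rightarrow> nat \<Rightarrow> complex \<Rightarrow> nat \<Rightarrow> complex" where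
  "sample_point a k b n =
     - (\<i> * of_real a * (2 * \<i> * b - 2 * of_nat n - 1 + 4 * of_nat k)
          * (\<i> * (2 * of_nat n - 1) + 2 * b)) / (4 * (2 * of_nat k - 1)\<^sup>2)"

definition residue_sum :: "(complex \<Rightarrow> complex) \<Rightarrow> real \<Rightarrow> nat \<Rightarrow> complex \<Rightarrow> complex" where
  "residue_sum F a k b =
     1 / ((2 * of_nat k - 1) * cosh (of_real pi * b))
       * (\<Sum>n = 1..2 * k - 1. (-1) ^ (n + 1) * F (sample_point a k b n))"

definition integrand :: "(complex \<Rightarrow> complex) \<Rightarrow> real \<Rightarrow> nat \<Rightarrow> complex \<Rightarrow> real \<Rightarrow> complex" where
  "integrand F a k b x =
     F (z_of a (of_real x)) * cosh (of_real (pi * (2 * real k - 1) * x))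
       / ((cosh (of_real pi * b))\<^sup>2 + (sinh (of_real (pi * (2 * real k - 1) * x)))\<^sup>2)"

definition product_integrand :: "(complex \<Rightarrow> complex) \<Rightarrow> real \<Rightarrow> nat \<Rightarrow> complex \<Rightarrow> real \<Rightarrow> complex" where
  "product_integrand F a k b x =
     F (z_of a (of_real x)) * cosh (of_real (pi * (2 * real k - 1) * x))
       / (cosh (of_real pi * (b + of_real ((2 * real k - 1) * x)))
          * cosh (of_real pi * (b - of_real ((2 * real k - 1) * x))))"

text \<open>
  Both the integrand and its integral are unchanged under \<open>b \<mapsto> b + \<i>\<close>, whereas \<open>residue_sum\<close> is
  not: for \<open>F = 1\<close>, \<open>k = 1\<close>, \<open>b = \<i>\<close> the integral is 1 and the sum is \<open>-1\<close>. The integral formula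
  therefore concerns \<open>\<bar>Im b\<bar> \<le> 1/2\<close>, which is the condition that the points
  \<open>-(\<i> * (2 * n - 1) + 2 * b) / (2 * (2 * k - 1))\<close>, sent by \<open>z_of a\<close> to the \<open>sample_point a k b n\<close>,
  lie in \<open>closed_strip\<close> for all \<open>n\<close>. On the boundary lines the integral exists only if zeros of \<open>F\<close> cancel
  the poles on the real axis; \<open>b = \<i>/2\<close> and \<open>b = -\<i>/2\<close> are left out because the denominator of the sum
  vanishes there.
\<close>

definition period_strip :: "complex set" where
  "period_strip = {b. \<bar>Im b\<bar> \<le> 1 / 2 \<and> cosh (of_real pi * b) \<noteq> 0}"

text \<open>
  Existence of the integral is Henstock--Kurzweil integrability over the real line, which
  covers absolutely convergent integrals as well as convergent improper ones.
\<close>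

definition integral_domain :: "(complex \<Rightarrow> complex) \<Rightarrow> real \<Rightarrow> nat \<Rightarrow> complex set" where
  "integral_domain F a k = {b \<in> period_strip. integrand F a k b integrable_on UNIV}"

definition sum_domain :: "(complex \<Rightarrow> complex) \<Rightarrow> real \<Rightarrow> nat \<Rightarrow> complex set" where
  "sum_domain F a k =
     {b. cosh (of_real pi * b) \<noteq> 0 \<and> (\<forall>n\<in>{1..2 * k - 1}. F analytic_on {sample_point a k b n})}"

definition analytic_continuation ::
    "(complex \<Rightarrow> complex) \<Rightarrow> complex set \<Rightarrow> (complex \<Rightarrow> complex) \<Rightarrow> complex set \<Rightarrow> bool" where
  "analytic_continuation f A g B \<longleftrightarrow>
     open A \<and> A \<noteq> {} \<and> f analytic_on A \<and> A \<subseteq> B \<and> connected B \<and> g analytic_on B \<and>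
     (\<forall>b\<in>A. g b = f b)"

end

theory Submission
  imports Defs
begin

text \<open>
  Write \<open>N = 2 k - 1\<close>, \<open>H x = F (z_of a x)\<close> and \<open>q x = cosh (\<pi> (b + N x))\<close>. The addition theorem turns
  the integrand into \<open>H x * (1 / q x + 1 / q (-x)) / (2 * cosh (\<pi> b))\<close> (lemma
  \<open>integrand_eq_sech_pair\<close>), so that only the simple poles of \<open>1 / q\<close> matter, for \<open>b = 0\<close> too.

  The strip is adapted to two symmetries: \<open>H (-\<i> - x) = H x\<close>, because \<open>x (x + \<i>)\<close> has this
  symmetry, and \<open>q (x - \<i>) = - q x\<close>, because \<open>N\<close> is odd. Integrate \<open>H / q\<close> around the rectangle
  with corners \<open>\<plusminus>R\<close> and \<open>\<plusminus>R - \<i>\<close>. The horizontal sides combine to \<open>- 2 * cosh (\<pi> b)\<close> times the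
  integral of the integrand over \<open>[-R, R]\<close> (lemma \<open>truncated_integral_bound\<close>), the residues at the
  \<open>N\<close> poles give the sum (lemma \<open>rectangle_sum\<close>), and the growth condition makes the vertical sides
  vanish in the limit (lemmas \<open>side_bound\<close> and \<open>integral_sech_pair\<close>).

  If \<open>\<bar>Im b\<bar> = 1/2\<close>, poles of \<open>1 / q\<close> lie on the horizontal sides. A function with a genuine simple pole
  on the real line is not integrable (lemma \<open>simple_pole_not_integrable\<close>), so existence of the
  integral forces \<open>H\<close> to vanish at these points (lemma \<open>vanishes_at_boundary_pole\<close>); the
  singularities are removable and the same argument applies.

  The sum is a composition of analytic functions of \<open>b\<close> (lemma \<open>residue_sum_analytic\<close>), which gives the
  continuation, and \<open>b = 0\<close> is the special case where the sum folds (lemma \<open>residue_sum_0\<close>).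
\<close>

section \<open>Simple poles and Henstock--Kurzweil integrability\<close>

text \<open>
  Conditional convergence does not rescue a pole, because cancellation between its two sides is not
  available to the part on the right of \<open>x0\<close> alone: if \<open>c \<noteq> 0\<close>, then \<open>Re (cnj c * f x)\<close> is there at least
  a positive multiple of \<open>1 / (x - x0)\<close>, whose integrals are logarithms without an upper bound.
\<close>

lemma simple_pole_not_integrable:
  fixes f :: "real \<Rightarrow> complex"
  assumes int: "f integrable_on UNIV"
    and lim: "((\<lambda>x. of_real (x - x0) * f x) \<longlongrightarrow> c) (at_right x0)"
  shows "c = 0"
proof (rule ccontr)
  assume c: "c \<noteq> 0"
  define u where "u = (\<lambda>x. Re (cnj c * f x))"
  define m where "m = (cmod c)\<^sup>2 / 2"
  have m: "m > 0" using c by (simp add: m_def)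
  have uint: "u integrable_on UNIV"
  proof -
    have "(\<lambda>x. cnj c * f x) integrable_on UNIV"
      using int by (rule integrable_on_mult_right)
    from integrable_linear[OF this bounded_linear_Re] show ?thesis
      by (simp add: u_def o_def)
  qed
  have "((\<lambda>x. Re (cnj c * (of_real (x - x0) * f x))) \<longlongrightarrow> Re (cnj c * c)) (at_right x0)"
    by (intro tendsto_intros lim)
  moreover have "Re (cnj c * c) = 2 * m"
    unfolding m_def cmod_power2 by (simp add: power2_eq_square)
  ultimately have "\<forall>\<^sub>F x in at_right x0. Re (cnj c * (of_real (x - x0) * f x)) > m"
    using m by (intro order_tendstoD(1)) auto
  moreover have "Re (cnj c * (of_real (x - x0) * f x)) = (x - x0) * u x" for x
    by (simp add: u_def algebra_simps)
  ultimately have "\<forall>\<^sub>F x in at_right x0. (x - x0) * u x > m" by simp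
  then obtain y where y: "y > x0" "\<And>x. x0 < x \<Longrightarrow> x < y \<Longrightarrow> (x - x0) * u x > m"
    by (auto simp: eventually_at_right_field)
  define d where "d = (y - x0) / 2"
  have d: "d > 0" using y by (simp add: d_def)
  have low: "u x \<ge> m / (x - x0)" if "x0 < x" "x \<le> x0 + d" for x
  proof -
    have "x < y" using that y(1) by (simp add: d_def field_simps)
    from y(2)[OF that(1) this] show ?thesis
      using that by (simp add: pos_divide_le_eq mult.commute)
  qed
  define v where "v = (\<lambda>x. if x = x0 then 0 else u x)"
  have uab: "u integrable_on {p..q}" for p q
    using integrable_on_subcbox[OF uint, of p q] by simp
  have vab: "v integrable_on {p..q}" for p q
    by (rule integrable_spike[OF uab, of "{x0}"]) (auto simp: v_def)
  have bound: "m * (ln d - ln e) \<le> integral {x0..x0 + d} v" if e: "0 < e" "e < d" for e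
  proof -
    have "((\<lambda>x. m / (x - x0)) has_integral (m * ln (x0 + d - x0) - m * ln (x0 + e - x0))) {x0 + e..x0 + d}"
      using e by (intro fundamental_theorem_of_calculus)
        (auto intro!: derivative_eq_intros simp flip: has_real_derivative_iff_has_vector_derivative)
    hence ln_int: "((\<lambda>x. m / (x - x0)) has_integral m * (ln d - ln e)) {x0 + e..x0 + d}"
      by (simp add: right_diff_distrib)
    hence i1: "(\<lambda>x. m / (x - x0)) integrable_on {x0 + e..x0 + d}"
      by (rule has_integral_integrable)
    have "m * (ln d - ln e) = integral {x0 + e..x0 + d} (\<lambda>x. m / (x - x0))"
      using ln_int by (simp add: integral_unique)
    also have "\<dots> \<le> integral {x0 + e..x0 + d} v"
      using e low by (intro integral_le i1 vab) (auto simp: v_def)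
    also have "\<dots> \<le> integral {x0..x0 + d} v"
    proof (intro integral_subset_le vab ballI)
      fix x assume x: "x \<in> {x0..x0 + d}"
      show "0 \<le> v x"
      proof (cases "x = x0")
        case False
        with x have "x > x0" "x \<le> x0 + d" by auto
        moreover from this have "0 \<le> m / (x - x0)" using m by simp
        ultimately show ?thesis using low[of x] False by (simp add: v_def)
      qed (simp add: v_def)
    qed (use e in auto)
    finally show ?thesis .
  qed
  define K where "K = integral {x0..x0 + d} v"
  (* chosen so that the logarithmic lower bound of the integral equals \<bar>K\<bar> + 1 *)
  define e where "e = d * exp (- (\<bar>K\<bar> + 1) / m)"
  have "0 < e" "e < d" using d m by (auto simp: e_def intro: divide_neg_pos)
  from bound[OF this] have "m * (ln d - ln e) \<le> K" by (simp add: K_def)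
  moreover have "m * (ln d - ln e) = \<bar>K\<bar> + 1"
  proof -
    have "ln e = ln d + (- (\<bar>K\<bar> + 1) / m)"
      unfolding e_def using d by (simp only: ln_mult_pos exp_gt_zero ln_exp)
    thus ?thesis using m by (simp add: field_simps)
  qed
  ultimately show False by linarith
qed

section \<open>The poles of the scaled hyperbolic secant\<close>

text \<open>
  The numbering is the one of the sum in the theorem: for \<open>\<bar>Im b\<bar> < 1/2\<close> the poles inside the strip
  are those with index \<open>1\<close> to \<open>N\<close>. Integer indices are allowed because a neighbourhood of the strip can
  contain the poles with index \<open>0\<close> and \<open>N + 1\<close> as well.
\<close>

definition sech_pole :: "nat \<Rightarrow> complex \<Rightarrow> int \<Rightarrow> complex" where
  "sech_pole N b n = - (b + \<i> * (of_int n - 1/2)) / of_nat N"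

abbreviation scaled_cosh :: "nat \<Rightarrow> complex \<Rightarrow> complex \<Rightarrow> complex" where
  "scaled_cosh N b x \<equiv> cosh (of_real pi * (b + of_nat N * x))"

lemma scaled_cosh_eq_0_iff:
  assumes "N > 0"
  shows "scaled_cosh N b x = 0 \<longleftrightarrow> (\<exists>n. x = sech_pole N b n)"
proof -
  have "scaled_cosh N b x = 0 \<longleftrightarrow>
      (\<exists>n::int. \<i> * (of_real pi * (b + of_nat N * x)) = complex_of_real (n * pi) + of_real pi / 2)"
    unfolding cosh_conv_cos cos_eq_0 ..
  also have "\<dots> \<longleftrightarrow> (\<exists>n::int. x = sech_pole N b (n + 1))"
  proof (intro ex_cong1)
    fix n :: int
    have "\<i> * (of_real pi * (b + of_nat N * x)) = complex_of_real (n * pi) + of_real pi / 2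
       \<longleftrightarrow> of_real pi * (\<i> * (b + of_nat N * x)) = of_real pi * (of_int n + 1 / 2)"
      by (simp add: algebra_simps)
    also have "\<dots> \<longleftrightarrow> \<i> * (b + of_nat N * x) = of_int n + 1 / 2"
      by (subst mult_left_cancel) auto
    also have "\<dots> \<longleftrightarrow> b + of_nat N * x = - (\<i> * (of_int n + 1 / 2))"
      by (auto simp: complex_eq_iff)
    also have "\<dots> \<longleftrightarrow> x = sech_pole N b (n + 1)"
      using assms by (auto simp: sech_pole_def field_simps)
    finally show "\<i> * (of_real pi * (b + of_nat N * x)) = complex_of_real (n * pi) + of_real pi / 2
       \<longleftrightarrow> x = sech_pole N b (n + 1)" .
  qed
  also have "\<dots> \<longleftrightarrow> (\<exists>n. x = sech_pole N b n)"
    by (metis diff_add_cancel)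
  finally show ?thesis .
qed

lemma Re_sech_pole: "Re (sech_pole N b n) = - Re b / real N"
  and Im_sech_pole: "Im (sech_pole N b n) = (1/2 - Im b - of_int n) / real N"
  by (simp_all add: sech_pole_def)

lemma has_field_derivative_scaled_cosh:
  "(scaled_cosh N b has_field_derivative of_real pi * of_nat N * sinh (of_real pi * (b + of_nat N * x))) (at x)"
  by (auto intro!: derivative_eq_intros)

lemma sinh_at_sech_pole:
  assumes "N > 0"
  shows "sinh (of_real pi * (b + of_nat N * sech_pole N b n)) = \<i> * (-1) powi n"
proof -
  have "of_real pi * (b + of_nat N * sech_pole N b n) = of_real pi * (- (\<i> * (of_int n - 1/2)))"
    using assms by (simp add: sech_pole_def field_simps)
  also have "\<dots> = \<i> * of_real (pi / 2 - pi * of_int n)"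
    by (simp add: algebra_simps)
  also have "sinh \<dots> = \<i> * of_real (sin (pi / 2 - pi * of_int n))"
    unfolding sinh_conv_sin by (simp add: sin_of_real [symmetric] sin_minus flip: mult.assoc del: of_real_diff)
  also have "sin (pi / 2 - pi * of_int n) = cos (of_int n * pi)"
    by (simp add: sin_diff mult.commute)
  also have "\<dots> = (-1) powi n" by (cases n rule: int_cases2) (auto simp: power_int_minus minus_one_power_iff)
  finally show ?thesis by simp
qed

section \<open>Residues in a rectangle\<close>

lemma remove_sings_quotient_analytic:
  assumes H: "H analytic_on {z}" "H z = 0"
    and q: "q analytic_on {z}" "(q has_field_derivative q') (at z)" "q z = 0" "q' \<noteq> 0"
  shows "remove_sings (\<lambda>w. H w / q w) analytic_on {z}"
proof (rule remove_sings_analytic_at)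
  show "isolated_singularity_at (\<lambda>w. H w / q w) z"
    using H(1) q(1)
    by (intro isolated_singularity_at_divide isolated_singularity_at_analytic not_essential_analytic)
  define H' where "H' = deriv H z"
  have "(H has_field_derivative H') (at z)"
    unfolding H'_def using H(1) by (metis analytic_derivI)
  hence "(\<lambda>w. (H w - H z) / (w - z)) \<midarrow>z\<rightarrow> H'"
    by (simp add: has_field_derivative_iff)
  moreover have "(\<lambda>w. (q w - q z) / (w - z)) \<midarrow>z\<rightarrow> q'"
    using q(2) by (simp add: has_field_derivative_iff)
  ultimately have "(\<lambda>w. ((H w - H z) / (w - z)) / ((q w - q z) / (w - z))) \<midarrow>z\<rightarrow> H' / q'"
    using q(4) by (rule tendsto_divide)
  moreover have "\<forall>\<^sub>F w in at z. ((H w - H z) / (w - z)) / ((q w - q z) / (w - z)) = H w / q w"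
    unfolding eventually_at_filter using H(2) q(3) by (auto intro!: always_eventually)
  ultimately show "(\<lambda>w. H w / q w) \<midarrow>z\<rightarrow> deriv H z / q'"
    unfolding H'_def by (rule Lim_transform_eventually)
qed

text \<open>
  The residue theorem for \<open>H / scaled_cosh N b\<close> on a rectangle spanning the strip. For \<open>\<bar>Im b\<bar> = 1/2\<close>
  some poles lie on the horizontal sides; there \<open>H\<close> vanishes by assumption, the singularity is
  removable, and \<open>f\<close> is the function with all such singularities filled in. Only the poles at which
  \<open>H\<close> does not vanish are given to the residue theorem, so none of them lies on the contour; the
  others contribute zero to the sum anyway.
\<close>

lemma rectangle_sum:
  fixes H :: "complex \<Rightarrow> complex"
  assumes N: "N > 0" and T: "open T" "closed_strip \<subseteq> T" "H holomorphic_on T"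
    and b: "\<bar>Im b\<bar> \<le> 1/2" and R: "\<bar>Re b\<bar> / real N < R"
    and vanish: "\<And>n. Im (sech_pole N b n) \<in> {-1, 0} \<Longrightarrow> H (sech_pole N b n) = 0"
  defines "\<gamma> \<equiv> rectpath (Complex (-R) (-1)) (Complex R 0)"
  obtains f where "continuous_on (path_image \<gamma>) f"
    "\<And>z. z \<in> path_image \<gamma> \<Longrightarrow> scaled_cosh N b z \<noteq> 0 \<Longrightarrow> f z = H z / scaled_cosh N b z"
    "contour_integral \<gamma> f = - (2 / of_nat N) * (\<Sum>n=1..N. (-1) ^ (n + 1) * H (sech_pole N b (int n)))"
proof -
  define p where "p = sech_pole N b"
  define q where "q = scaled_cosh N b"
  define f where "f = remove_sings (\<lambda>w. H w / q w)"
  define q' where "q' = (\<lambda>n. of_real pi * of_nat N * (\<i> * (-1) powi n) :: complex)"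
  (* a margin of 1 / N admits at most one pole on or beyond each side of the strip *)
  define X where "X = {z \<in> T. -1 - 1 / real N < Im z \<and> Im z < 1 / real N}"
  define S where "S = connected_component_set X 0"
  define I where "I = {n \<in> {0..int N + 1}. H (p n) \<noteq> 0}"
  have finite_I: "finite I"
    by (rule finite_subset[of _ "{0..int N + 1}"]) (auto simp: I_def)
  have R0: "R > 0" using R N by (smt (verit) divide_nonneg_nonneg abs_ge_zero of_nat_0_le_iff)
  have X: "open X"
  proof -
    have "X = T \<inter> {z. -1 - 1 / real N < Im z} \<inter> {z. Im z < 1 / real N}"
      by (auto simp: X_def)
    thus ?thesis using T(1) by (auto intro!: open_Int open_halfspace_Im_lt open_halfspace_Im_gt)
  qed
  have S: "open S" "connected S" "S \<subseteq> X"
    using X by (auto simp: S_def open_connected_component connected_component_subset)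
  have "closed_strip \<subseteq> S"
    unfolding S_def
  proof (rule connected_component_maximal)
    have "closed_strip = {z. Im z \<ge> -1} \<inter> {z. Im z \<le> 0}" by (auto simp: closed_strip_def)
    moreover have "convex ({z. Im z \<ge> -1} \<inter> {z. Im z \<le> 0})"
      by (intro convex_Int convex_halfspace_Im_le convex_halfspace_Im_ge)
    ultimately show "connected closed_strip" by (simp only: convex_connected)
    show "closed_strip \<subseteq> X" 
    proof
      fix x assume x: "x \<in> closed_strip"
      have "1 / real N > 0" using N by simp
      moreover have "-1 \<le> Im x" "Im x \<le> 0" using x by (auto simp: closed_strip_def)
      ultimately have "-1 - 1 / real N < Im x" "Im x < 1 / real N" by linarith+
      thus "x \<in> X" using x T(2) by (auto simp: X_def)
    qed
  qed (auto simp: closed_strip_def)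
  have cbox: "cbox (Complex (-R) (-1)) (Complex R 0) \<subseteq> closed_strip"
    by (auto simp: in_cbox_complex_iff closed_strip_def)
  have inj: "inj p" using N by (auto simp: inj_def p_def sech_pole_def)
  have p_index: "n \<in> {0..int N + 1}" if "p n \<in> X" for n
  proof -
    have "1/2 - Im b - of_int n < 1"  "1/2 - Im b - of_int n > - 1 - real N"
    proof -
      have "(1/2 - Im b - of_int n) / real N < 1 / real N"
        and *: "-1 - 1 / real N < (1/2 - Im b - of_int n) / real N"
        using that by (auto simp: X_def p_def Im_sech_pole)
      thus "1/2 - Im b - of_int n < 1" using N by (simp add: divide_less_cancel)
      have "-1 - 1 / real N = (-1 - real N) / real N" using N by (simp add: diff_divide_distrib)
      with * show "1/2 - Im b - of_int n > - 1 - real N" using N by (simp add: divide_less_cancel)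
    qed
    thus ?thesis using b by auto
  qed
  have q_zero: "q z = 0 \<longleftrightarrow> (\<exists>n. z = p n)" for z
    unfolding q_def p_def using scaled_cosh_eq_0_iff[OF N] .
  have q_deriv: "(q has_field_derivative q' n) (at (p n))" for n
    using has_field_derivative_scaled_cosh[where N = N and b = b and x = "p n"] sinh_at_sech_pole[OF N, of b n]
    by (simp add: q_def q'_def p_def)
  have q'_nz: "q' n \<noteq> 0" for n using N by (simp add: q'_def)
  have q_holo: "q holomorphic_on A" for A unfolding q_def cosh_conv_cos by (intro holomorphic_intros)
  have H_holo: "H holomorphic_on S" using T(3) S(3) by (auto simp: X_def elim: holomorphic_on_subset)
  have f_an: "f analytic_on {z}" if z: "z \<in> S - p ` I" for z
  proof (cases "q z = 0")
    case True
    then obtain n where n: "z = p n" using q_zero by blast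
    with z S(3) p_index have "n \<in> {0..int N + 1}" by blast
    with z n have "H z = 0" by (auto simp: I_def)
    thus ?thesis unfolding f_def using H_holo q_holo[of UNIV] S(1) z True q_deriv[of n] q'_nz[of n] n
      by (intro remove_sings_quotient_analytic[where q' = "q' n"]) (auto simp: analytic_at)
  next
    case False
    have "(\<lambda>w. H w / q w) analytic_on {z}"
      using H_holo q_holo[of UNIV] S(1) z False
      by (intro analytic_intros) (auto simp: analytic_at)
    thus ?thesis unfolding f_def by (rule remove_sings_analytic_on)
  qed
  have f_eq: "f z = H z / q z" if z: "z \<in> S" "q z \<noteq> 0" for z
    unfolding f_def using H_holo q_holo[of UNIV] S(1) z
    by (intro remove_sings_at_analytic analytic_intros) (auto simp: analytic_at)
  have f_holo: "f holomorphic_on S - p ` I"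
    using f_an by (meson analytic_imp_holomorphic analytic_on_analytic_at)
  have notbdry: "Im (p n) \<notin> {-1, 0}" if "n \<in> I" for n
    using vanish[of n] that by (auto simp: I_def p_def)
  have path: "path_image \<gamma> = {z. Re z \<in> {-R, R} \<and> Im z \<in> {-1..0}} \<union> {z. Im z \<in> {-1, 0} \<and> Re z \<in> {-R..R}}"
    unfolding \<gamma>_def using R0 by (subst path_image_rectpath) auto
  have Re_p: "-R < Re (p n)" "Re (p n) < R" for n
  proof -
    have "\<bar>Re (p n)\<bar> < R" using R by (simp add: p_def Re_sech_pole abs_divide)
    thus "-R < Re (p n)" "Re (p n) < R" by auto
  qed
  have sub: "path_image \<gamma> \<subseteq> S - p ` I"
  proof -
    have "path_image \<gamma> \<subseteq> closed_strip" by (auto simp: path closed_strip_def)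
    moreover have "p n \<notin> path_image \<gamma>" if "n \<in> I" for n
      using notbdry[OF that] Re_p[of n] by (auto simp: path)
    ultimately show ?thesis using \<open>closed_strip \<subseteq> S\<close> by blast
  qed
  have wind: "winding_number \<gamma> z = 0" if "z \<notin> cbox (Complex (-R) (-1)) (Complex R 0)" for z
    unfolding \<gamma>_def using that R0 by (intro winding_number_rectpath_outside) auto
  have "contour_integral \<gamma> f = 2 * pi * \<i> * (\<Sum>z\<in>p ` I. winding_number \<gamma> z * residue f z)"
  proof (rule Residue_theorem[OF S(1,2) _ f_holo _ _ sub])
    show "finite (p ` I)" using finite_I by simp
    show "\<forall>z. z \<notin> S \<longrightarrow> winding_number \<gamma> z = 0"
      using wind cbox \<open>closed_strip \<subseteq> S\<close> by blast
  qed (auto simp: \<gamma>_def)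
  also have "(\<Sum>z\<in>p ` I. winding_number \<gamma> z * residue f z) = (\<Sum>n\<in>I. winding_number \<gamma> (p n) * residue f (p n))"
    using inj by (simp add: sum.reindex inj_on_subset[OF inj] o_def)
  also have "\<dots> = (\<Sum>n\<in>I. if n \<in> {1..int N} then H (p n) / q' n else 0)"
  proof (rule sum.cong [OF refl])
    fix n assume n: "n \<in> I"
    have Im_p: "Im (p n) = (1/2 - Im b - of_int n) / real N" by (simp add: p_def Im_sech_pole)
    show "winding_number \<gamma> (p n) * residue f (p n) = (if n \<in> {1..int N} then H (p n) / q' n else 0)"
    proof (cases "n \<in> {1..int N}")
      case True
      hence "1 \<le> real_of_int n" "real_of_int n \<le> real N" by auto
      hence "1/2 - Im b - of_int n \<le> 0" "- real N \<le> 1/2 - Im b - of_int n" using b by linarith+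
      hence "Im (p n) \<le> 0" "-1 \<le> Im (p n)"
        unfolding Im_p using N by (auto simp: field_simps)
      with notbdry[OF n] have Im: "Im (p n) < 0" "-1 < Im (p n)" by auto
      hence "winding_number \<gamma> (p n) = 1"
        unfolding \<gamma>_def using Re_p[of n] by (intro winding_number_rectpath) (auto simp: in_box_complex_iff)
      moreover have pS: "p n \<in> S"
        using Im \<open>closed_strip \<subseteq> S\<close> by (auto simp: closed_strip_def)
      moreover have "residue f (p n) = H (p n) / q' n"
      proof -
        have "isolated_singularity_at (\<lambda>w. H w / q w) (p n)"
          using H_holo q_holo[of UNIV] S(1) pS
          by (intro isolated_singularity_at_divide isolated_singularity_at_analytic not_essential_analytic)
            (auto simp: analytic_at)
        hence "residue f (p n) = residue (\<lambda>w. H w / q w) (p n)"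
          unfolding f_def by (rule residue_remove_sings)
        also have "\<dots> = H (p n) / q' n"
          using q_deriv q'_nz n q_zero pS S
          by (intro residue_simple_pole_deriv[OF H_holo q_holo]) (auto simp: I_def)
        finally show ?thesis .
      qed
      ultimately show ?thesis using True by simp
    next
      case False
      with n have "n = 0 \<or> n = int N + 1" by (auto simp: I_def)
      hence "0 \<le> Im (p n) \<or> Im (p n) \<le> -1"
        unfolding Im_p using N b by (auto simp: field_simps)
      with notbdry[OF n] have "Im (p n) < -1 \<or> Im (p n) > 0" by auto
      hence "winding_number \<gamma> (p n) = 0" by (intro wind) (auto simp: in_cbox_complex_iff)
      thus ?thesis using False by auto
    qed
  qed
  also have "\<dots> = (\<Sum>n\<in>I \<inter> {1..int N}. H (p n) / q' n)"
    by (rule sum.inter_restrict [symmetric]) (rule finite_I)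
  also have "\<dots> = (\<Sum>n\<in>{1..int N}. H (p n) / q' n)"
    by (rule sum.mono_neutral_left) (auto simp: I_def)
  also have "{1..int N} = int ` {1..N}"
    by (simp add: image_int_atLeastAtMost)
  also have "(\<Sum>n\<in>int ` {1..N}. H (p n) / q' n) = (\<Sum>n=1..N. H (p (int n)) / q' (int n))"
    by (simp add: sum.reindex)
  also have "2 * pi * \<i> * \<dots> = - (2 / of_nat N) * (\<Sum>n=1..N. (-1) ^ (n + 1) * H (p (int n)))"
    unfolding sum_distrib_left
    by (intro sum.cong refl) (use N in \<open>auto simp: q'_def field_simps minus_one_power_iff\<close>)
  finally show thesis
    using that[of f] holomorphic_on_imp_continuous_on[OF f_holo] sub f_eq
    by (auto simp: p_def q_def intro: continuous_on_subset)
qed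

section \<open>The truncated integral\<close>

lemma contour_integral_linepath_same_Im:
  assumes "l < r"
  shows "contour_integral (linepath (Complex l y) (Complex r y)) f = integral {l..r} (\<lambda>x. f (Complex x y))"
proof -
  have "contour_integral (linepath (Complex l y) (Complex r y)) f
      = contour_integral (linepath (of_real l) (of_real r)) (\<lambda>z. f (z + \<i> * of_real y))"
    unfolding contour_integral_integral
    by (intro integral_cong)
      (simp add: linepath_def Complex_eq scaleR_conv_of_real algebra_simps)
  also have "\<dots> = integral {l..r} (\<lambda>x. f (of_real x + \<i> * of_real y))"
    using assms by (subst contour_integral_linepath_Reals_eq) auto
  finally show ?thesis by (simp add: Complex_eq)
qed

lemma scaled_cosh_shift:
  assumes "odd N"
  shows "scaled_cosh N b (x - \<i>) = - scaled_cosh N b x"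
proof -
  have i_t: "cosh (\<i> * of_real t) = of_real (cos t)" "sinh (\<i> * of_real t) = \<i> * of_real (sin t)" for t
    by (simp_all add: cosh_conv_cos sinh_conv_sin cos_of_real sin_of_real)
  have "scaled_cosh N b (x - \<i>) = cosh (of_real pi * (b + of_nat N * x) - \<i> * of_real (pi * real N))"
    by (simp add: algebra_simps)
  also have "\<dots> = - scaled_cosh N b x"
    unfolding cosh_diff i_t using assms by simp
  finally show ?thesis .
qed

lemma scaled_cosh_minus: "scaled_cosh N b (- x) = scaled_cosh N (- b) x"
  by (subst cosh_minus [symmetric]) (simp add: algebra_simps)

lemma scaled_cosh_add_reflected:
  "scaled_cosh N b x + scaled_cosh N b (- x) = 2 * cosh (of_real pi * b) * cosh (of_real pi * (of_nat N * x))"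
  by (simp add: algebra_simps cosh_add cosh_diff)

lemma Re_zero_scaled_cosh:
  assumes "N > 0" "scaled_cosh N b x = 0"
  shows "Re x = - Re b / real N"
  using assms by (auto simp: scaled_cosh_eq_0_iff Re_sech_pole)

text \<open>
  The even part of \<open>1 / scaled_cosh N b\<close>, doubled: comparing the two horizontal sides of the rectangle
  produces exactly this combination.
\<close>

definition sech_pair :: "nat \<Rightarrow> complex \<Rightarrow> real \<Rightarrow> complex" where
  "sech_pair N b x = 1 / scaled_cosh N b (of_real x) + 1 / scaled_cosh N b (- of_real x)"

text \<open>
  Since \<open>N\<close> is odd, \<open>scaled_cosh N b\<close> changes sign under \<open>x \<mapsto> x - \<i>\<close>, while \<open>H\<close> is
  unchanged under \<open>x \<mapsto> -\<i> - x\<close>. After substituting \<open>-x\<close> for \<open>x\<close> on the lower side, the two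
  horizontal sides together therefore contribute minus the integral of \<open>H\<close> times \<open>sech_pair\<close>, and
  what remains is the contribution of the two vertical sides of length one.
\<close>

lemma truncated_integral_bound:
  fixes H :: "complex \<Rightarrow> complex"
  assumes N: "odd N" and T: "open T" "closed_strip \<subseteq> T" "H holomorphic_on T"
    and sym: "\<And>x. H (- \<i> - x) = H x"
    and b: "\<bar>Im b\<bar> \<le> 1/2" and R: "\<bar>Re b\<bar> / real N < R"
    and vanish: "\<And>n. Im (sech_pole N b n) \<in> {-1, 0} \<Longrightarrow> H (sech_pole N b n) = 0"
    and M: "\<And>z. z \<in> closed_strip \<Longrightarrow> \<bar>Re z\<bar> = R \<Longrightarrow> cmod (H z / scaled_cosh N b z) \<le> M"
  shows "cmod (integral {-R..R} (\<lambda>x. H (of_real x) * sech_pair N b x)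
      - 2 / of_nat N * (\<Sum>n=1..N. (-1) ^ (n + 1) * H (sech_pole N b (int n)))) \<le> 2 * M"
proof -
  have N0: "N > 0" using N by (cases N) auto
  have R0: "R > 0" using R N0 by (smt (verit) divide_nonneg_nonneg abs_ge_zero of_nat_0_le_iff)
  define \<gamma> where "\<gamma> = rectpath (Complex (-R) (-1)) (Complex R 0)"
  obtain f where f: "continuous_on (path_image \<gamma>) f"
    "\<And>z. z \<in> path_image \<gamma> \<Longrightarrow> scaled_cosh N b z \<noteq> 0 \<Longrightarrow> f z = H z / scaled_cosh N b z"
    "contour_integral \<gamma> f = - (2 / of_nat N) * (\<Sum>n=1..N. (-1) ^ (n + 1) * H (sech_pole N b (int n)))"
    by (rule rectangle_sum[OF N0 T b R vanish, folded \<gamma>_def], assumption) (rule that)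
  have path: "path_image \<gamma> = {z. Re z \<in> {-R, R} \<and> Im z \<in> {-1..0}} \<union> {z. Im z \<in> {-1, 0} \<and> Re z \<in> {-R..R}}"
    unfolding \<gamma>_def using R0 by (subst path_image_rectpath) auto
  have seg: "closed_segment (Complex (-R) (-1)) (Complex R (-1)) \<subseteq> path_image \<gamma>"
    "closed_segment (Complex R (-1)) (Complex R 0) \<subseteq> path_image \<gamma>"
    "closed_segment (Complex R 0) (Complex (-R) 0) \<subseteq> path_image \<gamma>"
    "closed_segment (Complex (-R) 0) (Complex (-R) (-1)) \<subseteq> path_image \<gamma>"
    using R0 by (auto simp: path closed_segment_same_Re closed_segment_same_Im closed_segment_eq_real_ivl)
  have ci: "f contour_integrable_on linepath u v" if "closed_segment u v \<subseteq> path_image \<gamma>" for u v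
    using that f(1) by (intro contour_integrable_continuous_linepath) (rule continuous_on_subset)
  define V1 where "V1 = contour_integral (linepath (Complex R (-1)) (Complex R 0)) f"
  define V2 where "V2 = contour_integral (linepath (Complex (-R) 0) (Complex (-R) (-1))) f"
  have "contour_integral \<gamma> f = contour_integral (linepath (Complex (-R) (-1)) (Complex R (-1))) f + (V1
      + (contour_integral (linepath (Complex R 0) (Complex (-R) 0)) f + V2))"
    unfolding \<gamma>_def rectpath_def Let_def V1_def V2_def using ci seg
    by (simp add: contour_integrable_joinI)
  also have "contour_integral (linepath (Complex (-R) (-1)) (Complex R (-1))) f
      = integral {-R..R} (\<lambda>x. f (Complex x (-1)))"
    using R0 by (intro contour_integral_linepath_same_Im) auto
  also have "\<dots> = integral {-R..R} (\<lambda>x. f (Complex (- x) (-1)))"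
    using Henstock_Kurzweil_Integration.integral_reflect_real[of R "-R" "\<lambda>x. f (Complex x (-1))"] by simp
  also have "contour_integral (linepath (Complex R 0) (Complex (-R) 0)) f
      = - integral {-R..R} (\<lambda>x. f (Complex x 0))"
    using R0 ci[OF seg(3)]
    by (subst contour_integral_reverse_linepath)
      (auto simp: contour_integral_linepath_same_Im closed_segment_commute
        intro!: continuous_on_subset[OF f(1)] seg)
  finally have split: "contour_integral \<gamma> f =
      (integral {-R..R} (\<lambda>x. f (Complex (- x) (-1))) - integral {-R..R} (\<lambda>x. f (Complex x 0))) + (V1 + V2)"
    by simp
  have "integral {-R..R} (\<lambda>x. f (Complex (- x) (-1))) - integral {-R..R} (\<lambda>x. f (Complex x 0))
      = integral {-R..R} (\<lambda>x. f (Complex (- x) (-1)) - f (Complex x 0))"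
    by (intro integral_diff [symmetric] integrable_continuous_real continuous_on_compose2[OF f(1)])
      (auto simp: path Complex_eq intro!: continuous_intros)
  also have "\<dots> = integral {-R..R} (\<lambda>x. - (H (of_real x) * sech_pair N b x))"
  proof (rule integral_spike[of "{- Re b / real N, Re b / real N}"])
    fix x assume x: "x \<in> {-R..R} - {- Re b / real N, Re b / real N}"
    have nz: "scaled_cosh N b (of_real x) \<noteq> 0" "scaled_cosh N b (- of_real x) \<noteq> 0"
      using x Re_zero_scaled_cosh[OF N0, of b "of_real x"] Re_zero_scaled_cosh[OF N0, of b "- of_real x"] by auto
    have eq: "Complex (- x) (-1) = - \<i> - of_real x" "Complex x 0 = of_real x"
      by (simp_all add: complex_eq_iff)
    have "- of_real x - \<i> = - \<i> - complex_of_real x" by simp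
    hence shift: "scaled_cosh N b (- \<i> - of_real x) = - scaled_cosh N b (- of_real x)"
      using scaled_cosh_shift[OF N, of b "- of_real x"] by (simp only:)
    have "f (Complex (- x) (-1)) = H (- \<i> - of_real x) / scaled_cosh N b (- \<i> - of_real x)"
      unfolding eq using x nz(2) by (intro f(2)) (auto simp: path shift simp del: minus_diff_eq)
    moreover have "f (Complex x 0) = H (of_real x) / scaled_cosh N b (of_real x)"
      using x nz(1) by (subst f(2)) (auto simp: path eq)
    ultimately show "- (H (of_real x) * sech_pair N b x)
        = f (Complex (- x) (-1)) - f (Complex x 0)"
      unfolding sym shift by (simp add: sech_pair_def algebra_simps)
  qed auto
  also have "\<dots> = - integral {-R..R} (\<lambda>x. H (of_real x) * sech_pair N b x)"
    by (rule integral_neg)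
  finally have eq: "integral {-R..R} (\<lambda>x. H (of_real x) * sech_pair N b x)
      - 2 / of_nat N * (\<Sum>n=1..N. (-1) ^ (n + 1) * H (sech_pole N b (int n))) = V1 + V2"
    using split f(3) by (simp add: algebra_simps)
  have fM: "cmod (f z) \<le> M" if z: "z \<in> closed_strip" "\<bar>Re z\<bar> = R" for z
  proof -
    have "scaled_cosh N b z \<noteq> 0" using Re_zero_scaled_cosh[OF N0, of b z] z R N0 by auto
    moreover have "z \<in> path_image \<gamma>" using z by (auto simp: path closed_strip_def abs_if split: if_splits)
    ultimately show ?thesis using f(2) M[OF z] by simp
  qed
  have M0: "M \<ge> 0"
  proof -
    have "Complex R 0 \<in> closed_strip" "\<bar>Re (Complex R 0)\<bar> = R" using R0 by (auto simp: closed_strip_def)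
    from order_trans[OF norm_ge_zero fM[OF this]] show ?thesis .
  qed
  have "cmod V1 \<le> M * cmod (Complex R 0 - Complex R (-1))"
    unfolding V1_def using R0
    by (intro contour_integral_bound_linepath ci seg M0 fM)
      (auto simp: closed_segment_same_Re closed_segment_eq_real_ivl closed_strip_def)
  moreover have "cmod V2 \<le> M * cmod (Complex (-R) (-1) - Complex (-R) 0)"
    unfolding V2_def using R0
    by (intro contour_integral_bound_linepath ci seg M0 fM)
      (auto simp: closed_segment_same_Re closed_segment_eq_real_ivl closed_strip_def)
  ultimately show ?thesis
    unfolding eq using norm_triangle_ineq[of V1 V2] by (simp add: cmod_def)
qed

section \<open>Passing to the limit\<close>

lemma exp_le_cosh:
  assumes "\<bar>Re w\<bar> \<ge> 1"
  shows "exp \<bar>Re w\<bar> / 4 \<le> cmod (cosh w)"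
proof -
  define u where "u = \<bar>Re w\<bar>"
  have pm: "exp u - exp (- u) \<le> cmod (exp w + exp (- w))"
    using norm_diff_ineq[of "exp w" "exp (- w)"] norm_diff_ineq[of "exp (- w)" "exp w"]
    by (auto simp: u_def abs_if add.commute)
  have "2 \<le> exp (2 * u)" using exp_ge_add_one_self[of "2 * u"] assms unfolding u_def by linarith
  hence "2 * exp (- u) \<le> exp (2 * u) * exp (- u)" by (intro mult_right_mono) auto
  also have "\<dots> = exp u" by (simp flip: exp_add)
  finally have "exp u / 2 \<le> cmod (exp w + exp (- w))" using pm by simp
  thus ?thesis by (simp add: cosh_field_def norm_divide u_def)
qed

lemma sech_pair_minus: "sech_pair N (- b) x = sech_pair N b x"
  using scaled_cosh_minus[where N = N and b = b and x = "of_real x"]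
    scaled_cosh_minus[where N = N and b = b and x = "- of_real x"]
  by (simp add: sech_pair_def)

lemma cosh_complex_of_real: "cosh (complex_of_real t) = of_real (cosh t)"
  by (simp add: cosh_field_def flip: exp_of_real)

text \<open>
  The two summands of \<open>sech_pair\<close> cannot both have a pole at \<open>x0\<close>: their denominators add up to
  \<open>2 * cosh (\<pi> b) * cosh (\<pi> N x0)\<close>, which is not zero. So the pole is simple and only a zero of \<open>H\<close>
  can make the product integrable.
\<close>

lemma vanishes_at_real_pole:
  fixes H :: "complex \<Rightarrow> complex"
  assumes N: "N > 0" and H: "isCont H (of_real x0)"
    and b: "cosh (of_real pi * b) \<noteq> 0" and zero: "scaled_cosh N b (of_real x0) = 0"
    and int: "(\<lambda>x. H (of_real x) * sech_pair N b x) integrable_on UNIV"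
  shows "H (of_real x0) = 0"
proof -
  define q where "q = scaled_cosh N b"
  obtain n where n: "of_real x0 = sech_pole N b n" using zero scaled_cosh_eq_0_iff[OF N] by blast
  define q' where "q' = of_real pi * of_nat N * (\<i> * (-1) powi n)"
  have q'_nz: "q' \<noteq> 0" using N by (simp add: q'_def)
  have refl: "q (- of_real x0) \<noteq> 0"
  proof -
    have "cosh (of_real pi * (of_nat N * of_real x0)) = complex_of_real (cosh (pi * (real N * x0)))"
      using cosh_complex_of_real[of "pi * (real N * x0)"] by simp
    hence "cosh (of_real pi * (of_nat N * of_real x0)) \<noteq> (0 :: complex)"
      by (simp add: cosh_real_nonzero)
    thus ?thesis using scaled_cosh_add_reflected[where N = N and b = b and x = "of_real x0"] zero b by (auto simp: q_def)
  qed
  have "(\<lambda>w. (q w - q (of_real x0)) / (w - of_real x0)) \<midarrow>of_real x0\<rightarrow> q'"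
    using has_field_derivative_scaled_cosh[where N = N and b = b and x = "of_real x0"]
      sinh_at_sech_pole[OF N, of b n]
    by (simp add: has_field_derivative_iff q_def q'_def n)
  moreover have at: "filterlim complex_of_real (at (of_real x0)) (at_right x0)"
    unfolding filterlim_at by (auto intro!: tendsto_intros simp: eventually_at_filter)
  ultimately have "((\<lambda>x. (q (of_real x) - q (of_real x0)) / (of_real x - of_real x0)) \<longlongrightarrow> q') (at_right x0)"
    by (rule filterlim_compose)
  hence "((\<lambda>x. inverse (q (of_real x) / of_real (x - x0))) \<longlongrightarrow> inverse q') (at_right x0)"
    using q'_nz zero by (intro tendsto_inverse) (simp_all add: q_def)
  hence lim1: "((\<lambda>x. of_real (x - x0) / q (of_real x)) \<longlongrightarrow> inverse q') (at_right x0)"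
    by simp
  have "isCont (\<lambda>w. 1 / q (- w)) (of_real x0)"
    using refl unfolding q_def cosh_conv_cos by (intro continuous_intros) auto
  hence "((\<lambda>x. 1 / q (- of_real x)) \<longlongrightarrow> 1 / q (- of_real x0)) (at_right x0)"
    unfolding isCont_def using at by (rule filterlim_compose)
  moreover have "((\<lambda>x. complex_of_real (x - x0)) \<longlongrightarrow> of_real (x0 - x0)) (at_right x0)"
    by (intro tendsto_intros)
  ultimately have lim2: "((\<lambda>x. of_real (x - x0) * (1 / q (- of_real x))) \<longlongrightarrow> of_real (x0 - x0) * (1 / q (- of_real x0))) (at_right x0)"
    by (intro tendsto_mult)
  have "((\<lambda>x. H (of_real x)) \<longlongrightarrow> H (of_real x0)) (at_right x0)"
    using H at unfolding isCont_def by (rule filterlim_compose)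
  from tendsto_mult[OF this tendsto_add[OF lim1 lim2]]
  have "((\<lambda>x. of_real (x - x0) * (H (of_real x) * sech_pair N b x)) \<longlongrightarrow> H (of_real x0) * inverse q') (at_right x0)"
    by (simp add: sech_pair_def q_def algebra_simps)
  from simple_pole_not_integrable[OF int this] show ?thesis
    using q'_nz by simp
qed

text \<open>
  A pole on the lower line is carried to a real pole for the parameter \<open>-b\<close> by \<open>x \<mapsto> -\<i> - x\<close>,
  which does not change \<open>H\<close>.
\<close>

lemma vanishes_at_boundary_pole:
  fixes H :: "complex \<Rightarrow> complex"
  assumes N: "odd N" and T: "open T" "closed_strip \<subseteq> T" "H holomorphic_on T"
    and sym: "\<And>x. H (- \<i> - x) = H x"
    and b: "cosh (of_real pi * b) \<noteq> 0"
    and int: "(\<lambda>x. H (of_real x) * sech_pair N b x) integrable_on UNIV"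
    and bdry: "Im (sech_pole N b n) \<in> {-1, 0}"
  shows "H (sech_pole N b n) = 0"
proof -
  have N0: "N > 0" using N by (cases N) auto
  define p where "p = sech_pole N b n"
  have zero: "scaled_cosh N b p = 0" using scaled_cosh_eq_0_iff[OF N0] by (auto simp: p_def)
  have cont: "isCont H (of_real x)" for x
  proof -
    have "of_real x \<in> T" using T(2) by (auto simp: closed_strip_def)
    thus ?thesis using T(1,3) holomorphic_on_imp_continuous_on continuous_on_eq_continuous_at by blast
  qed
  show ?thesis
  proof (cases "Im p = 0")
    case True
    hence p: "p = of_real (Re p)" by (simp add: complex_eq_iff)
    show ?thesis
      using vanishes_at_real_pole[OF N0 cont b _ int, of "Re p"] zero p unfolding p_def by metis
  next
    case False
    hence p: "p = of_real (Re p) - \<i>" using bdry by (auto simp: complex_eq_iff p_def)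
    have "scaled_cosh N b (of_real (Re p)) = 0"
      using zero scaled_cosh_shift[OF N, of b "of_real (Re p)"] p by simp
    hence "scaled_cosh N (- b) (of_real (- Re p)) = 0"
      using scaled_cosh_minus[where N = N and b = b and x = "- of_real (Re p)"] by simp
    hence "H (of_real (- Re p)) = 0"
      using b int by (intro vanishes_at_real_pole[OF N0 cont, where b = "- b"]) (simp_all add: sech_pair_minus)
    moreover have "H p = H (of_real (- Re p))"
      using sym[of p] p by (metis add.commute add_diff_cancel_left' diff_diff_eq2 minus_diff_eq of_real_minus uminus_add_conv_diff)
    ultimately show ?thesis by (simp add: p_def)
  qed
qed

text \<open>
  For \<open>N \<ge> 1\<close> the denominator grows at least like \<open>exp (\<pi> \<bar>Re z\<bar>)\<close>, which compensates the permitted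
  growth of \<open>H\<close>; the bound does not depend on \<open>z\<close>, so it becomes small with \<open>e\<close>.
\<close>

lemma side_bound:
  fixes H :: "complex \<Rightarrow> complex"
  assumes N: "N > 0" and z: "z \<in> closed_strip" "\<bar>Re z\<bar> \<ge> \<bar>Re b\<bar> + 1"
    and e: "e > 0" "cmod (H z) \<le> e * (exp (pi * cmod z) / cmod z)"
  shows "cmod (H z / scaled_cosh N b z) \<le> e * (4 * exp (pi * (1 + \<bar>Re b\<bar>)))"
proof -
  define r where "r = \<bar>Re z\<bar>"
  define w where "w = of_real pi * (b + of_nat N * z)"
  have z1: "1 \<le> cmod z" using z abs_Re_le_cmod[of z] by linarith
  have z2: "cmod z \<le> r + 1"
    using cmod_le[of z] z(1) by (auto simp: r_def closed_strip_def)
  have "r \<le> real N * r"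
    using N mult_right_mono[of 1 "real N" r] by (simp add: r_def)
  also have "real N * r = \<bar>real N * Re z\<bar>" by (simp add: r_def abs_mult)
  also have "\<dots> \<le> \<bar>Re b + real N * Re z\<bar> + \<bar>Re b\<bar>" by linarith
  finally have "r - \<bar>Re b\<bar> \<le> \<bar>Re b + real N * Re z\<bar>" by simp
  hence "pi * (r - \<bar>Re b\<bar>) \<le> pi * \<bar>Re b + real N * Re z\<bar>" by simp
  also have "\<dots> = \<bar>Re w\<bar>" by (simp add: w_def abs_mult)
  finally have w: "pi * (r - \<bar>Re b\<bar>) \<le> \<bar>Re w\<bar>" .
  have "1 \<le> pi * (r - \<bar>Re b\<bar>)"
    using z(2) pi_ge_two mult_mono[of 1 pi 1 "r - \<bar>Re b\<bar>"] by (simp add: r_def)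
  hence "exp \<bar>Re w\<bar> / 4 \<le> cmod (cosh w)" using w by (intro exp_le_cosh) linarith
  moreover have "exp (pi * (r - \<bar>Re b\<bar>)) \<le> exp \<bar>Re w\<bar>" using w by simp
  ultimately have den: "exp (pi * (r - \<bar>Re b\<bar>)) / 4 \<le> cmod (cosh w)" by linarith
  have "exp (pi * cmod z) / cmod z \<le> exp (pi * (r + 1)) / 1"
    using z1 z2 by (intro frac_le) auto
  hence "e * (exp (pi * cmod z) / cmod z) \<le> e * exp (pi * (r + 1))"
    using e(1) by (intro mult_left_mono) auto
  with e(2) have num: "cmod (H z) \<le> e * exp (pi * (r + 1))" by linarith
  have "cmod (H z / scaled_cosh N b z) = cmod (H z) / cmod (cosh w)" by (simp add: norm_divide w_def)
  also have "\<dots> \<le> e * exp (pi * (r + 1)) / (exp (pi * (r - \<bar>Re b\<bar>)) / 4)"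
    using num den e(1) by (intro frac_le) auto
  also have "\<dots> = e * (4 * (exp (pi * (r + 1)) / exp (pi * (r - \<bar>Re b\<bar>))))" by simp
  also have "exp (pi * (r + 1)) / exp (pi * (r - \<bar>Re b\<bar>)) = exp (pi * (1 + \<bar>Re b\<bar>))"
    by (simp add: algebra_simps flip: exp_diff)
  finally show ?thesis .
qed

text \<open>
  Henstock--Kurzweil integrability over the line implies that the integrals over \<open>[-R, R]\<close>
  converge to the integral. This is all that is known about convergence: for \<open>N = 1\<close> the growth
  condition does not make the integral absolutely convergent.
\<close>

lemma integral_sech_pair:
  fixes H :: "complex \<Rightarrow> complex"
  assumes N: "odd N" and T: "open T" "closed_strip \<subseteq> T" "H holomorphic_on T"
    and sym: "\<And>x. H (- \<i> - x) = H x"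
    and growth: "\<And>e. e > 0 \<Longrightarrow> \<exists>B. \<forall>z\<in>closed_strip. B \<le> \<bar>Re z\<bar> \<longrightarrow> cmod (H z) \<le> e * (exp (pi * cmod z) / cmod z)"
    and b: "\<bar>Im b\<bar> \<le> 1/2" "cosh (of_real pi * b) \<noteq> 0"
    and int: "(\<lambda>x. H (of_real x) * sech_pair N b x) integrable_on UNIV"
  shows "integral UNIV (\<lambda>x. H (of_real x) * sech_pair N b x)
    = 2 / of_nat N * (\<Sum>n=1..N. (-1) ^ (n + 1) * H (sech_pole N b (int n)))"
proof -
  have N0: "N > 0" using N by (cases N) auto
  define g where "g = (\<lambda>x. H (of_real x) * sech_pair N b x)"
  define \<Sigma> where "\<Sigma> = 2 / of_nat N * (\<Sum>n=1..N. (-1) ^ (n + 1) * H (sech_pole N b (int n)))"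
  define K where "K = 4 * exp (pi * (1 + \<bar>Re b\<bar>))"
  have K: "K > 0" by (simp add: K_def)
  have "cmod (integral UNIV g - \<Sigma>) \<le> e" if e: "e > 0" for e
  proof -
    (* two vertical sides, each contributing at most d * K, share half of the error e *)
    define d where "d = e / (4 * K)"
    have d: "d > 0" using e K by (simp add: d_def)
    obtain B where B: "\<And>z. z \<in> closed_strip \<Longrightarrow> B \<le> \<bar>Re z\<bar> \<Longrightarrow> cmod (H z) \<le> d * (exp (pi * cmod z) / cmod z)"
      using growth[OF d] by blast
    have "(g has_integral integral UNIV g) UNIV" using int by (simp add: g_def integrable_integral)
    hence "\<forall>e>0. \<exists>C>0. \<forall>u v. ball 0 C \<subseteq> cbox u v \<longrightarrow> cmod (integral (cbox u v) g - integral UNIV g) < e"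
      unfolding has_integral_alt' by simp
    with half_gt_zero[OF e] obtain C where C: "\<And>u v. ball 0 C \<subseteq> cbox u v \<Longrightarrow> cmod (integral (cbox u v) g - integral UNIV g) < e / 2"
      by blast
    define R where "R = max (max B C) (\<bar>Re b\<bar> + 1)"
    have R: "B \<le> R" "C \<le> R" "\<bar>Re b\<bar> + 1 \<le> R" by (auto simp: R_def)
    have "ball 0 C \<subseteq> cbox (-R) R" using R(2) by (auto simp: dist_real_def)
    from C[OF this] have 1: "cmod (integral {-R..R} g - integral UNIV g) < e / 2" by simp
    have "\<bar>Re b\<bar> / real N \<le> \<bar>Re b\<bar> / 1" using N0 by (intro divide_left_mono) auto
    hence "\<bar>Re b\<bar> / real N < R" using R(3) by simp
    moreover have "cmod (H z / scaled_cosh N b z) \<le> d * K" if "z \<in> closed_strip" "\<bar>Re z\<bar> = R" for z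
      unfolding K_def using that R d by (intro side_bound[OF N0] B) auto
    ultimately have "cmod (integral {-R..R} g - \<Sigma>) \<le> 2 * (d * K)"
      unfolding g_def \<Sigma>_def
      by (intro truncated_integral_bound[OF N T sym b(1)] vanishes_at_boundary_pole[OF N T sym b(2) int])
    also have "2 * (d * K) = e / 2" using K by (simp add: d_def)
    finally show ?thesis
      using 1 norm_triangle_ineq4[of "integral {-R..R} g - \<Sigma>" "integral {-R..R} g - integral UNIV g"] by simp
  qed
  hence "cmod (integral UNIV g - \<Sigma>) \<le> 0" by (rule field_le_epsilon) simp
  thus ?thesis by (simp add: g_def \<Sigma>_def)
qed

section \<open>The integral formula\<close>

lemma product_integrand_eq: "product_integrand F a k b = integrand F a k b"
proof
  fix x
  have "cosh (u + v) * cosh (u - v) = (cosh u)\<^sup>2 + (sinh v)\<^sup>2" for u v :: complex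
  proof -
    have "cosh (u + v) * cosh (u - v) = (cosh u)\<^sup>2 * (cosh v)\<^sup>2 - (sinh u)\<^sup>2 * (sinh v)\<^sup>2"
      by (simp add: cosh_add cosh_diff algebra_simps power2_eq_square)
    also have "\<dots> = (cosh u)\<^sup>2 + (sinh v)\<^sup>2"
      by (simp add: cosh_square_eq algebra_simps)
    finally show ?thesis .
  qed
  from this[of "of_real pi * b" "of_real (pi * (2 * real k - 1) * x)"]
  show "product_integrand F a k b x = integrand F a k b x"
    by (simp add: product_integrand_def integrand_def algebra_simps)
qed

text \<open>
  With \<open>u = \<pi> b\<close> and \<open>v = \<pi> N x\<close>, the partial fraction decomposition comes from
  \<open>cosh (u + v) + cosh (u - v) = 2 * cosh u * cosh v\<close>. It separates the two families of poles, and it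
  covers \<open>b = 0\<close>, where the families coincide. The two excluded points are the only real ones that
  can be poles; there the value \<open>0\<close> of a division by zero would spoil the identity.
\<close>

lemma integrand_eq_sech_pair:
  assumes k: "k \<ge> 1" and b: "cosh (of_real pi * b) \<noteq> 0"
    and x: "x \<noteq> - Re b / real (2 * k - 1)" "x \<noteq> Re b / real (2 * k - 1)"
  shows "integrand F a k b x = F (z_of a (of_real x)) * sech_pair (2 * k - 1) b x / (2 * cosh (of_real pi * b))"
proof -
  define N where "N = 2 * k - 1"
  have N: "N > 0" "complex_of_nat N = 2 * of_nat k - 1" "real N = 2 * real k - 1"
    using k by (auto simp: N_def of_nat_diff)
  define u where "u = scaled_cosh N b (of_real x)"
  define v where "v = scaled_cosh N b (- of_real x)"
  have nz: "u \<noteq> 0" "v \<noteq> 0"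
    unfolding u_def v_def
    using x Re_zero_scaled_cosh[OF N(1), of b "of_real x"] Re_zero_scaled_cosh[OF N(1), of b "- of_real x"]
    by (auto simp: N_def)
  define c where "c = cosh (complex_of_real (pi * (2 * real k - 1) * x))"
  have "u + v = 2 * cosh (of_real pi * b) * c"
    unfolding u_def v_def scaled_cosh_add_reflected by (simp add: c_def N algebra_simps)
  hence uv: "c = (u + v) / (2 * cosh (of_real pi * b))" using b by simp
  have "integrand F a k b x = F (z_of a (of_real x)) * c / (u * v)"
    unfolding product_integrand_eq [symmetric] product_integrand_def u_def v_def c_def
    by (simp add: N algebra_simps)
  also have "\<dots> = F (z_of a (of_real x)) * (1 / u + 1 / v) / (2 * cosh (of_real pi * b))"
    unfolding uv using nz b by (simp add: field_simps)
  finally show ?thesis by (simp add: sech_pair_def u_def v_def N_def)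
qed

lemma z_of_reflect: "z_of a (- \<i> - x) = z_of a x"
  by (simp add: z_of_def algebra_simps)

lemma sample_point_eq:
  assumes "k \<ge> 1"
  shows "sample_point a k b n = z_of a (sech_pole (2 * k - 1) b (int n))"
proof -
  define N :: complex where "N = of_nat (2 * k - 1)"
  have N: "2 * of_nat k - 1 = N" "4 * of_nat k = 2 * N + 2"
    using assms by (simp_all add: N_def of_nat_diff algebra_simps)
  have "2 * k - 1 \<noteq> 0" using assms by simp
  hence N0: "N \<noteq> 0" unfolding N_def of_nat_eq_0_iff .
  define s where "s = b + \<i> * (of_nat n - 1/2)"
  have "sample_point a k b n = - (\<i> * of_real a * (2 * \<i> * (s - \<i> * N)) * (2 * s)) / (4 * N\<^sup>2)"
    unfolding sample_point_def N by (simp add: s_def algebra_simps)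
  also have "\<dots> = of_real a * (- s / N) * (- s / N + \<i>)"
    using N0 by (simp add: field_simps power2_eq_square)
  also have "- s / N = sech_pole (2 * k - 1) b (int n)"
    by (simp add: sech_pole_def s_def N_def)
  finally show ?thesis by (simp add: z_of_def)
qed

text \<open>
  The condition \<open>\<bar>Im b\<bar> \<le> 1/2\<close> puts the poles with index \<open>1\<close> to \<open>2 k - 1\<close> into the closed strip.
\<close>

lemma period_strip_subset_sum_domain:
  assumes k: "k \<ge> 1" and F: "F analytic_on z_of a ` closed_strip"
  shows "period_strip \<subseteq> sum_domain F a k"
proof
  fix b assume b: "b \<in> period_strip"
  have "F analytic_on {sample_point a k b n}" if n: "n \<in> {1..2 * k - 1}" for n
  proof -
    define N where "N = 2 * k - 1"
    have N: "N > 0" "n \<le> N" "1 \<le> n" using k n by (auto simp: N_def)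
    have "real n \<le> real N" "1 \<le> real n" using N by simp_all
    moreover have "\<bar>Im b\<bar> \<le> 1/2" using b by (simp add: period_strip_def)
    ultimately have "1/2 - Im b - real n \<le> 0" "- 1 * real N \<le> 1/2 - Im b - real n" by linarith+
    hence "(1/2 - Im b - real n) / real N \<le> 0" "- 1 \<le> (1/2 - Im b - real n) / real N"
      using N(1) by (simp_all only: pos_le_divide_eq of_nat_0_less_iff divide_nonpos_pos)
    hence "sech_pole N b (int n) \<in> closed_strip"
      by (simp add: closed_strip_def Im_sech_pole)
    hence "sample_point a k b n \<in> z_of a ` closed_strip"
      using k by (simp add: sample_point_eq N_def)
    thus ?thesis using F by (auto elim: analytic_on_subset)
  qed
  thus "b \<in> sum_domain F a k" using b by (simp add: sum_domain_def period_strip_def)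
qed

lemma residue_sum_analytic:
  assumes k: "k \<ge> 1" and B: "B \<subseteq> sum_domain F a k"
  shows "residue_sum F a k analytic_on B"
proof -
  have k0: "2 * of_nat k - 1 \<noteq> (0 :: complex)"
  proof
    assume "2 * of_nat k - 1 = (0 :: complex)"
    hence "of_nat (2 * k) = (of_nat 1 :: complex)" by simp
    hence "2 * k = 1" unfolding of_nat_eq_iff .
    thus False by presburger
  qed
  have "(\<lambda>b. F (sample_point a k b n)) analytic_on B" if n: "n \<in> {1..2 * k - 1}" for n
  proof -
    have "(\<lambda>b. sample_point a k b n) analytic_on B"
      unfolding sample_point_def using k0 by (intro analytic_intros) auto
    moreover have "F analytic_on (\<lambda>b. sample_point a k b n) ` B"
      using B n by (subst analytic_on_analytic_at) (auto simp: sum_domain_def)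
    ultimately show ?thesis by (rule analytic_on_compose[unfolded o_def])
  qed
  moreover have "cosh (of_real pi * b) \<noteq> 0" if "b \<in> B" for b
    using that B by (auto simp: sum_domain_def)
  ultimately show ?thesis
    unfolding residue_sum_def cosh_conv_cos using k0
    by (intro analytic_intros) (auto simp: cosh_conv_cos)
qed

lemma integral_eq_residue_sum:
  fixes F :: "complex \<Rightarrow> complex" and a :: real and k :: nat
  assumes k: "k \<ge> 1"
    and F: "F analytic_on (z_of a ` closed_strip)"
    and growth: "(\<lambda>x. F (z_of a x)) \<in>
           o[inf (filtercomap Re at_infinity) (principal closed_strip)](\<lambda>x. exp (of_real (pi * cmod x)) / x)"
    and b: "b \<in> integral_domain F a k"
  shows "integral UNIV (integrand F a k b) = residue_sum F a k b"
proof -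
  define N where "N = 2 * k - 1"
  have N: "odd N" "complex_of_nat N = 2 * of_nat k - 1"
    using k by (auto simp: N_def of_nat_diff)
  define H where "H = (\<lambda>x. F (z_of a x))"
  define C where "C = cosh (of_real pi * b)"
  have b': "\<bar>Im b\<bar> \<le> 1/2" "C \<noteq> 0" and int: "integrand F a k b integrable_on UNIV"
    using b by (auto simp: integral_domain_def period_strip_def C_def)
  have "z_of a analytic_on closed_strip"
    unfolding z_of_def [abs_def] by (intro analytic_intros)
  hence "(F \<circ> z_of a) analytic_on closed_strip" using F by (rule analytic_on_compose)
  hence "H analytic_on closed_strip" by (simp add: H_def o_def)
  then obtain T where T: "open T" "closed_strip \<subseteq> T" "H holomorphic_on T"
    by (auto simp: analytic_on_holomorphic)
  have gr: "\<exists>B. \<forall>z\<in>closed_strip. B \<le> \<bar>Re z\<bar> \<longrightarrow> cmod (H z) \<le> e * (exp (pi * cmod z) / cmod z)" if "e > 0" for e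
  proof -
    have "\<forall>\<^sub>F x in inf (filtercomap Re at_infinity) (principal closed_strip).
        cmod (H x) \<le> e * cmod (exp (of_real (pi * cmod x)) / x)"
      unfolding H_def using landau_o.smallD[OF growth that] .
    then obtain P where P: "eventually P at_infinity"
      "\<And>x. P (Re x) \<Longrightarrow> x \<in> closed_strip \<Longrightarrow> cmod (H x) \<le> e * cmod (exp (of_real (pi * cmod x)) / x)"
      unfolding eventually_inf_principal eventually_filtercomap by blast
    from P(1) obtain B where B: "\<And>x. B \<le> \<bar>x\<bar> \<Longrightarrow> P x"
      by (auto simp: eventually_at_infinity)
    have "cmod (H z) \<le> e * (exp (pi * cmod z) / cmod z)" if z: "z \<in> closed_strip" "B \<le> \<bar>Re z\<bar>" for z
      using P(2)[OF B[OF z(2)] z(1)] by (simp add: norm_divide)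
    thus ?thesis by blast
  qed
  have pair: "integrand F a k b x = H (of_real x) * sech_pair N b x / (2 * C)"
    if "x \<in> UNIV - {- Re b / real N, Re b / real N}" for x
    using that integrand_eq_sech_pair[OF k b'(2)[unfolded C_def]] by (simp add: H_def N_def C_def)
  have "(\<lambda>x. 2 * C * integrand F a k b x) integrable_on UNIV"
    using int by (rule integrable_on_mult_right)
  hence pint: "(\<lambda>x. H (of_real x) * sech_pair N b x) integrable_on UNIV"
    by (rule integrable_spike[of _ _ "{- Re b / real N, Re b / real N}"]) (use pair b' in auto)
  have "integral UNIV (integrand F a k b) = integral UNIV (\<lambda>x. H (of_real x) * sech_pair N b x / (2 * C))"
    by (rule integral_spike[of "{- Re b / real N, Re b / real N}"]) (use pair in auto)
  also have "\<dots> = integral UNIV (\<lambda>x. H (of_real x) * sech_pair N b x) / (2 * C)"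
    by (rule integral_divide)
  also have "integral UNIV (\<lambda>x. H (of_real x) * sech_pair N b x)
      = 2 / of_nat N * (\<Sum>n=1..N. (-1) ^ (n + 1) * H (sech_pole N b (int n)))"
    using b' by (intro integral_sech_pair[OF N(1) T _ gr _ _ pint]) (auto simp: H_def z_of_reflect C_def)
  also have "\<dots> / (2 * C) = residue_sum F a k b"
    unfolding residue_sum_def sample_point_eq[OF k] N(2) [symmetric] by (simp add: H_def C_def N_def)
  finally show ?thesis .
qed

text \<open>
  At \<open>b = 0\<close> the sample points with index \<open>k - m\<close> and \<open>k + m\<close> coincide and carry the same sign, so the
  sum folds around its middle term.
\<close>

lemma residue_sum_0:
  assumes k: "k \<ge> 1"
  shows "residue_sum F a k 0 =
    (-1) ^ (k + 1) * F (of_real a / 4) / (2 * of_nat k - 1)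
    - 2 * (-1) ^ k / (2 * of_nat k - 1)
      * (\<Sum>n = 1..k - 1. (-1) ^ n *
           F (of_real a * ((2 * of_nat k - 1)\<^sup>2 - 4 * (of_nat n)\<^sup>2) / (4 * (2 * of_nat k - 1)\<^sup>2)))"
proof -
  define N :: complex where "N = 2 * of_nat k - 1"
  define t where "t = (\<lambda>n. (-1) ^ (n + 1) * F (sample_point a k 0 n))"
  define y where "y = (\<lambda>m. F (of_real a * (N\<^sup>2 - 4 * (of_nat m)\<^sup>2) / (4 * N\<^sup>2)))"
  have N0: "N \<noteq> 0"
  proof
    assume "N = 0"
    hence "of_nat (2 * k) = (of_nat 1 :: complex)" by (simp add: N_def)
    hence "2 * k = 1" unfolding of_nat_eq_iff .
    thus False by presburger
  qed
  have sp: "sample_point a k 0 n = of_real a * (N\<^sup>2 - 4 * (of_nat n - of_nat k)\<^sup>2) / (4 * N\<^sup>2)" for n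
    unfolding sample_point_def by (simp add: N_def power2_eq_square algebra_simps)
  have tk: "t k = (-1) ^ (k + 1) * F (of_real a / 4)"
    using N0 by (simp add: t_def sp)
  have tm: "t (k - m) = (-1) ^ (k + 1) * ((-1) ^ m * y m)" if "m \<in> {1..k - 1}" for m
  proof -
    from that have "m \<le> k" by auto
    then obtain j where j: "k = m + j" using le_Suc_ex by blast
    have diff: "k - m = j" "of_nat j - of_nat k = - (of_nat m :: complex)" by (simp_all add: j)
    have sign: "(-1) ^ (j + 1) = (-1) ^ (k + 1) * (-1 :: complex) ^ m"
      by (simp add: j minus_one_power_iff)
    show ?thesis unfolding diff t_def sp y_def sign by (simp add: diff)
  qed
  have tp: "t (k + m) = (-1) ^ (k + 1) * ((-1) ^ m * y m)" for m
    by (simp add: t_def sp y_def power_add)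
  have "{1..2 * k - 1} = {1..k - 1} \<union> ({k} \<union> {k + 1..2 * k - 1})" using k by auto
  hence "sum t {1..2 * k - 1} = sum t ({1..k - 1} \<union> ({k} \<union> {k + 1..2 * k - 1}))" by (rule arg_cong)
  also have "\<dots> = sum t {1..k - 1} + (t k + sum t {k + 1..2 * k - 1})"
    by (subst sum.union_disjoint) auto
  also have "sum t {1..k - 1} = (\<Sum>m=1..k - 1. t (k - m))"
    by (rule sum.reindex_bij_witness[of _ "\<lambda>m. k - m" "\<lambda>n. k - n"]) auto
  also have "\<dots> = (\<Sum>m=1..k - 1. (-1) ^ (k + 1) * ((-1) ^ m * y m))"
    by (intro sum.cong refl tm)
  also have "sum t {k + 1..2 * k - 1} = (\<Sum>m=1..k - 1. t (k + m))"
    by (rule sum.reindex_bij_witness[of _ "\<lambda>m. k + m" "\<lambda>n. n - k"]) auto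
  also have "\<dots> = (\<Sum>m=1..k - 1. (-1) ^ (k + 1) * ((-1) ^ m * y m))"
    by (intro sum.cong refl tp)
  finally have "sum t {1..2 * k - 1} = (-1) ^ (k + 1) * F (of_real a / 4)
      + 2 * (-1) ^ (k + 1) * (\<Sum>m=1..k - 1. (-1) ^ m * y m)"
    unfolding tk sum_distrib_left [symmetric] by (simp add: algebra_simps)
  thus ?thesis
    unfolding residue_sum_def N_def [symmetric] t_def y_def
    using N0 by (simp add: field_simps)
qed

theorem mainTheorem10:
  fixes F :: "complex \<Rightarrow> complex" and a :: real and k :: nat
  assumes "k \<ge> 1"
    and "F analytic_on (z_of a ` closed_strip)"
    and "(\<lambda>x. F (z_of a x)) \<in>
           o[inf (filtercomap Re at_infinity) (principal closed_strip)](\<lambda>x. exp (of_real (pi * cmod x)) / x)"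
  shows "(\<forall>b \<in> integral_domain F a k.
             integral UNIV (integrand F a k b) = integral UNIV (product_integrand F a k b) \<and>
             integral UNIV (product_integrand F a k b) = residue_sum F a k b)
       \<and> period_strip \<subseteq> sum_domain F a k
       \<and> (\<forall>A B. open A \<and> A \<noteq> {} \<and> A \<subseteq> integral_domain F a k \<and>
               A \<subseteq> B \<and> connected B \<and> B \<subseteq> sum_domain F a k \<longrightarrow>
             analytic_continuation (\<lambda>b. integral UNIV (integrand F a k b)) A
               (residue_sum F a k) B)
       \<and> ((\<lambda>x::real. F (z_of a (of_real x)) / cosh (of_real (pi * (2 * real k - 1) * x)))
               integrable_on UNIV \<longrightarrow>
             integral UNIV (\<lambda>x::real. F (z_of a (of_real x))
                                / cosh (of_real (pi * (2 * real k - 1) * x))) =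
               (-1) ^ (k + 1) * F (of_real a / 4) / (2 * of_nat k - 1)
               - 2 * (-1) ^ k / (2 * of_nat k - 1)
                 * (\<Sum>n = 1..k - 1. (-1) ^ n *
                      F (of_real a * ((2 * of_nat k - 1)\<^sup>2 - 4 * (of_nat n)\<^sup>2)
                           / (4 * (2 * of_nat k - 1)\<^sup>2))))"
proof (intro conjI ballI allI impI)
  note integral_eq = integral_eq_residue_sum[OF assms]
  fix b assume "b \<in> integral_domain F a k"
  thus "integral UNIV (product_integrand F a k b) = residue_sum F a k b"
    by (simp add: product_integrand_eq integral_eq)
next
  show "period_strip \<subseteq> sum_domain F a k"
    by (rule period_strip_subset_sum_domain[OF assms(1,2)])
next
  fix A B
  assume AB: "open A \<and> A \<noteq> {} \<and> A \<subseteq> integral_domain F a k \<and>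
    A \<subseteq> B \<and> connected B \<and> B \<subseteq> sum_domain F a k"
  have eq: "residue_sum F a k b = integral UNIV (integrand F a k b)" if "b \<in> A" for b
    using AB that integral_eq_residue_sum[OF assms, of b] by auto
  have an: "residue_sum F a k analytic_on B" using AB assms(1) by (intro residue_sum_analytic) auto
  have "residue_sum F a k holomorphic_on A"
    using an AB by (meson analytic_imp_holomorphic analytic_on_subset)
  hence "(\<lambda>b. integral UNIV (integrand F a k b)) holomorphic_on A"
    using eq by (rule holomorphic_transform)
  thus "analytic_continuation (\<lambda>b. integral UNIV (integrand F a k b)) A (residue_sum F a k) B"
    using AB an eq by (auto simp: analytic_continuation_def analytic_on_open)
next
  have "1 + (sinh c)\<^sup>2 = (cosh c)\<^sup>2" for c :: complex
    by (simp add: cosh_square_eq)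
  hence eq: "(\<lambda>x::real. F (z_of a (of_real x)) / cosh (of_real (pi * (2 * real k - 1) * x))) = integrand F a k 0"
    by (simp add: integrand_def fun_eq_iff power2_eq_square)
  assume "(\<lambda>x::real. F (z_of a (of_real x)) / cosh (of_real (pi * (2 * real k - 1) * x))) integrable_on UNIV"
  hence "0 \<in> integral_domain F a k"
    unfolding eq by (simp add: integral_domain_def period_strip_def)
  from integral_eq_residue_sum[OF assms this]
  show "integral UNIV (\<lambda>x::real. F (z_of a (of_real x)) / cosh (of_real (pi * (2 * real k - 1) * x))) =
      (-1) ^ (k + 1) * F (of_real a / 4) / (2 * of_nat k - 1)
      - 2 * (-1) ^ k / (2 * of_nat k - 1)
        * (\<Sum>n = 1..k - 1. (-1) ^ n *
             F (of_real a * ((2 * of_nat k - 1)\<^sup>2 - 4 * (of_nat n)\<^sup>2) / (4 * (2 * of_nat k - 1)\<^sup>2)))"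
    unfolding eq residue_sum_0[OF assms(1)] .
qed (simp add: product_integrand_eq)

end
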